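(* Asymptotic coarse Lipschitz equivalence is an equivalence relation on the class of metric spaces.
   Context: Let $(X,d)$ and $(Y,\partial)$ be metric spaces. A map $f:X\to Y$ is coarse Lipschitz if there is $L>0$ such that $\partial(f(x),f(x'))\le L\,d(x,x')+L$ for all $x,x'\in X$. Two maps $f,g:X\to Y$ are asymptotically close, written $f\sim_\infty g$, if for some $x_0\in X$ one has $\lim_{x\to\infty}\frac{\partial(f(x),g(x))}{d(x,x_0)}=0$, where $x\to\infty$ means $d(x,x_0)\to\infty$; if $X$ is bounded, any two maps $X\to Y$ are by convention asymptotically close. $X$ and $Y$ are asymptotically coarse Lipschitz equivalent if there are coarse Lipschitz maps $f:X\to Y$ and $g:Y\to X$ with $g\circ f\sim_\infty \mathrm{Id}_X$ and $f\circ g\sim_\infty \mathrm{Id}_Y$. *)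

theory Defs
  imports "HOL-Analysis.Analysis"
begin

text \<open>
  A metric space is an element of the library type \<open>'a metric\<close>, that is, an arbitrary
  carrier set \<open>mspace X\<close> (a subset of the type \<open>'a\<close>, possibly empty) with a
  metric \<open>mdist X\<close> on it.  Maps between metric spaces are HOL functions of which only the
  values on the carrier matter.
\<close>

definition coarse_Lipschitz_map :: "'a metric \<Rightarrow> 'b metric \<Rightarrow> ('a \<Rightarrow> 'b) \<Rightarrow> bool" where
  "coarse_Lipschitz_map X Y f \<longleftrightarrow>
     f \<in> mspace X \<rightarrow> mspace Y \<and>
     (\<exists>L>0. \<forall>x \<in> mspace X. \<forall>x' \<in> mspace X.
        mdist Y (f x) (f x') \<le> L * mdist X x x' + L)"

text \<open>
  The filter of \<open>x \<rightarrow> \<infinity>\<close> in \<open>X\<close>, seen from the base point \<open>x0\<close>: \<open>x\<close> runs through the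
  carrier of \<open>X\<close> and its distance to \<open>x0\<close> tends to infinity.
\<close>

definition metric_at_infinity :: "'a metric \<Rightarrow> 'a \<Rightarrow> 'a filter" where
  "metric_at_infinity X x0 =
     inf (filtercomap (\<lambda>x. mdist X x x0) at_top) (principal (mspace X))"

text \<open>
  The first disjunct is the convention that any two maps on a bounded space are
  asymptotically close; it also covers the empty space, which has no base point.
\<close>

definition asymptotically_close ::
    "'a metric \<Rightarrow> 'b metric \<Rightarrow> ('a \<Rightarrow> 'b) \<Rightarrow> ('a \<Rightarrow> 'b) \<Rightarrow> bool" where
  "asymptotically_close X Y f g \<longleftrightarrow>
     Metric_space.mbounded (mspace X) (mdist X) (mspace X) \<or>
     (\<exists>x0 \<in> mspace X.
        ((\<lambda>x. mdist Y (f x) (g x) / mdist X x x0) \<longlongrightarrow> 0) (metric_at_infinity X x0))"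

definition asymptotically_coarse_Lipschitz_equivalent :: "'a metric \<Rightarrow> 'b metric \<Rightarrow> bool" where
  "asymptotically_coarse_Lipschitz_equivalent X Y \<longleftrightarrow>
     (\<exists>f g. coarse_Lipschitz_map X Y f \<and> coarse_Lipschitz_map Y X g \<and>
        asymptotically_close X X (g \<circ> f) id \<and> asymptotically_close Y Y (f \<circ> g) id)"

end

theory Submission
  imports Defs
begin

text \<open>
  For coarse Lipschitz maps \<open>f\<close> and \<open>g\<close>, which are bounded on bounded sets, asymptotic closeness
  amounts to a bound \<open>\<partial>(f x, g x) \<le> \<epsilon> d(x, x0) + C\<close> on all of \<open>X\<close>, for every \<open>\<epsilon> > 0\<close> and every
  base point \<open>x0\<close>, with \<open>C\<close> depending on both; this covers bounded and empty \<open>X\<close> as well.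
  Transitivity then follows from the triangle inequality through \<open>g (f x)\<close>: if \<open>p = k \<circ> h\<close> is
  the round trip from \<open>Y\<close> through \<open>Z\<close>, then \<open>p\<close> moves \<open>f x\<close> by at most \<open>\<epsilon> \<partial>(f x, f x0) + C\<close>,
  and the coarse Lipschitz maps \<open>f\<close> and \<open>g\<close> distort such a bound only by fixed constants.
\<close>

definition sublinearly_close ::
    "'a metric \<Rightarrow> 'b metric \<Rightarrow> ('a \<Rightarrow> 'b) \<Rightarrow> ('a \<Rightarrow> 'b) \<Rightarrow> bool" where
  "sublinearly_close X Y f g \<longleftrightarrow>
     (\<forall>x0 \<in> mspace X. \<forall>\<epsilon>>0. \<exists>C. \<forall>x \<in> mspace X. mdist Y (f x) (g x) \<le> \<epsilon> * mdist X x x0 + C)"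

section \<open>Coarse Lipschitz maps and composition\<close>

lemma coarse_Lipschitz_mapE:
  assumes "coarse_Lipschitz_map X Y f"
  obtains L where "L > 0" "\<And>x. x \<in> mspace X \<Longrightarrow> f x \<in> mspace Y"
    "\<And>x x'. x \<in> mspace X \<Longrightarrow> x' \<in> mspace X \<Longrightarrow> mdist Y (f x) (f x') \<le> L * mdist X x x' + L"
  using assms unfolding coarse_Lipschitz_map_def by blast

lemma coarse_Lipschitz_map_id: "coarse_Lipschitz_map X X id"
  unfolding coarse_Lipschitz_map_def by (auto intro!: exI[of _ 1])

lemma coarse_Lipschitz_map_compose:
  assumes "coarse_Lipschitz_map X Y f" "coarse_Lipschitz_map Y Z g"
  shows "coarse_Lipschitz_map X Z (g \<circ> f)"
proof -
  obtain L where L: "L > 0" "\<And>x. x \<in> mspace X \<Longrightarrow> f x \<in> mspace Y"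
    "\<And>x x'. x \<in> mspace X \<Longrightarrow> x' \<in> mspace X \<Longrightarrow> mdist Y (f x) (f x') \<le> L * mdist X x x' + L"
    using coarse_Lipschitz_mapE[OF assms(1)] by blast
  obtain M where M: "M > 0" "\<And>y. y \<in> mspace Y \<Longrightarrow> g y \<in> mspace Z"
    "\<And>y y'. y \<in> mspace Y \<Longrightarrow> y' \<in> mspace Y \<Longrightarrow> mdist Z (g y) (g y') \<le> M * mdist Y y y' + M"
    using coarse_Lipschitz_mapE[OF assms(2)] by blast
  \<comment> \<open>Slope \<open>M * L\<close> would do; the extra \<open>M\<close> lets one
    constant serve as both slope and additive term.\<close>
  have "mdist Z (g (f x)) (g (f x')) \<le> (M * L + M) * mdist X x x' + (M * L + M)"
    if x: "x \<in> mspace X" "x' \<in> mspace X" for x x'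
  proof -
    have "mdist Z (g (f x)) (g (f x')) \<le> M * mdist Y (f x) (f x') + M"
      using L M x by simp
    also have "\<dots> \<le> M * (L * mdist X x x' + L) + M"
      using L(3)[OF x] M(1) by simp
    also have "\<dots> \<le> (M * L + M) * mdist X x x' + (M * L + M)"
      using M(1) by (simp add: algebra_simps)
    finally show ?thesis .
  qed
  moreover have "M * L + M > 0"
    using L(1) M(1) by (simp add: add_pos_pos)
  ultimately show ?thesis
    unfolding coarse_Lipschitz_map_def using L(2) M(2) by (auto intro!: exI[of _ "M * L + M"])
qed

text \<open>On a ball both maps stay within bounded distance of their values at the centre, so the
  triangle inequality through \<open>f x0\<close> and \<open>g x0\<close> applies. This covers the
  region about which a limit at infinity says nothing.\<close>

lemma mdist_maps_bounded_on_balls: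
  assumes f: "coarse_Lipschitz_map X Y f" and g: "coarse_Lipschitz_map X Y g"
    and x0: "x0 \<in> mspace X"
  obtains C where "C \<ge> 0"
    "\<And>x. x \<in> mspace X \<Longrightarrow> mdist X x x0 \<le> R \<Longrightarrow> mdist Y (f x) (g x) \<le> C"
proof -
  obtain L where L: "L > 0" "\<And>x. x \<in> mspace X \<Longrightarrow> f x \<in> mspace Y"
    "\<And>x x'. x \<in> mspace X \<Longrightarrow> x' \<in> mspace X \<Longrightarrow> mdist Y (f x) (f x') \<le> L * mdist X x x' + L"
    using coarse_Lipschitz_mapE[OF f] by blast
  obtain M where M: "M > 0" "\<And>x. x \<in> mspace X \<Longrightarrow> g x \<in> mspace Y"
    "\<And>x x'. x \<in> mspace X \<Longrightarrow> x' \<in> mspace X \<Longrightarrow> mdist Y (g x) (g x') \<le> M * mdist X x x' + M"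
    using coarse_Lipschitz_mapE[OF g] by blast
  define C where "C = (L * R + L) + mdist Y (f x0) (g x0) + (M * R + M)"
  have "mdist Y (f x) (g x) \<le> C" if x: "x \<in> mspace X" "mdist X x x0 \<le> R" for x
  proof -
    have "mdist Y (f x) (g x) \<le> mdist Y (f x) (f x0) + mdist Y (f x0) (g x)"
      using L M x x0 by (intro mdist_triangle) auto
    moreover have "mdist Y (f x0) (g x) \<le> mdist Y (f x0) (g x0) + mdist Y (g x0) (g x)"
      using L M x x0 by (intro mdist_triangle) auto
    moreover have "mdist Y (f x) (f x0) \<le> L * R + L"
      using L(3)[OF x(1) x0] mult_left_mono[OF x(2), of L] L(1) by linarith
    moreover have "mdist Y (g x0) (g x) \<le> M * R + M"
      using M(3)[OF x0 x(1)] mult_left_mono[OF x(2), of M] M(1)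
      unfolding mdist_commute[of X x0 x] by linarith
    ultimately show ?thesis unfolding C_def by linarith
  qed
  \<comment> \<open>For a negative radius \<open>R\<close> the ball is empty and the explicit
    constant may be negative, hence the maximum with \<open>0\<close>.\<close>
  then show thesis
    by (intro that[of "max C 0"]) (auto intro: max.coboundedI1)
qed

section \<open>Asymptotic closeness and sublinear bounds\<close>

lemma mbounded_mspace_dist_le:
  assumes "Metric_space.mbounded (mspace X) (mdist X) (mspace X)" "x0 \<in> mspace X"
  obtains R where "\<And>x. x \<in> mspace X \<Longrightarrow> mdist X x x0 \<le> R"
proof -
  obtain R where "\<forall>x \<in> mspace X. \<forall>y \<in> mspace X. mdist X x y \<le> R"
    using assms(1) unfolding Metric_space.mbounded_alt[OF Metric_space_mspace_mdist] by blast
  then show thesis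
    using assms(2) that by blast
qed

lemma eventually_metric_at_infinity:
  "eventually P (metric_at_infinity X x0) \<longleftrightarrow>
    (\<exists>R. \<forall>x \<in> mspace X. mdist X x x0 \<ge> R \<longrightarrow> P x)"
  unfolding metric_at_infinity_def eventually_inf_principal eventually_filtercomap_at_top_linorder
  by blast

text \<open>Far from the base point the limit gives slope \<epsilon>; on the remaining ball the
  distance of the two maps is bounded, which goes into the constant. A bounded space is itself such
  a ball.\<close>

lemma asymptotically_close_imp_sublinearly_close:
  assumes f: "coarse_Lipschitz_map X Y f" and g: "coarse_Lipschitz_map X Y g"
    and close: "asymptotically_close X Y f g"
  shows "sublinearly_close X Y f g"
  unfolding sublinearly_close_def
proof (intro ballI allI impI)
  fix x1 and \<epsilon> :: real assume x1: "x1 \<in> mspace X" and \<epsilon>: "\<epsilon> > 0"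
  from close consider "Metric_space.mbounded (mspace X) (mdist X) (mspace X)"
    | x0 where "x0 \<in> mspace X"
      "((\<lambda>x. mdist Y (f x) (g x) / mdist X x x0) \<longlongrightarrow> 0) (metric_at_infinity X x0)"
    unfolding asymptotically_close_def by blast
  then show "\<exists>C. \<forall>x \<in> mspace X. mdist Y (f x) (g x) \<le> \<epsilon> * mdist X x x1 + C"
  proof cases
    case 1
    obtain R where R: "\<And>x. x \<in> mspace X \<Longrightarrow> mdist X x x1 \<le> R"
      using mbounded_mspace_dist_le[OF 1 x1] by blast
    obtain C where C: "\<And>x. x \<in> mspace X \<Longrightarrow> mdist X x x1 \<le> R \<Longrightarrow> mdist Y (f x) (g x) \<le> C"
      using mdist_maps_bounded_on_balls[OF f g x1, of R] by blast
    have "mdist Y (f x) (g x) \<le> \<epsilon> * mdist X x x1 + C" if x: "x \<in> mspace X" for x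
    proof (rule add_increasing)
      show "0 \<le> \<epsilon> * mdist X x x1"
        using \<epsilon> by simp
      show "mdist Y (f x) (g x) \<le> C"
        using C[OF x R[OF x]] .
    qed
    then show ?thesis by blast
  next
    case 2
    obtain R where R:
      "\<And>x. x \<in> mspace X \<Longrightarrow> mdist X x x0 \<ge> R \<Longrightarrow> mdist Y (f x) (g x) / mdist X x x0 < \<epsilon>"
      using order_tendstoD(2)[OF 2(2) \<epsilon>] unfolding eventually_metric_at_infinity by blast
    \<comment> \<open>Outside radius \<open>max R 1\<close> the denominator is positive, so the
      quotient bound can be multiplied out; at \<open>x0\<close> itself it would only concern a
      division by zero.\<close>
    obtain C where C: "C \<ge> 0"
      "\<And>x. x \<in> mspace X \<Longrightarrow> mdist X x x0 \<le> max R 1 \<Longrightarrow> mdist Y (f x) (g x) \<le> C"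
      using mdist_maps_bounded_on_balls[OF f g 2(1), of "max R 1"] by blast
    \<comment> \<open>Moving the base point from \<open>x0\<close> to \<open>x1\<close> costs the
      fixed amount \<open>\<epsilon> * mdist X x1 x0\<close>.\<close>
    have "mdist Y (f x) (g x) \<le> \<epsilon> * mdist X x x1 + (\<epsilon> * mdist X x1 x0 + C)"
      if x: "x \<in> mspace X" for x
    proof -
      have "mdist Y (f x) (g x) \<le> \<epsilon> * mdist X x x0 + C"
      proof (cases "mdist X x x0 \<le> max R 1")
        case True
        have "0 \<le> \<epsilon> * mdist X x x0"
          using \<epsilon> by simp
        then show ?thesis
          using C(2)[OF x True] by (rule add_increasing)
      next
        case False
        then have "mdist X x x0 > 0" "mdist X x x0 \<ge> R" by auto
        then show ?thesis using R[OF x] C(1) by (simp add: divide_less_eq)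
      qed
      moreover have "\<epsilon> * mdist X x x0 \<le> \<epsilon> * (mdist X x x1 + mdist X x1 x0)"
        using \<epsilon> x x1 2(1) by (intro mult_left_mono mdist_triangle) auto
      ultimately show ?thesis by (simp add: distrib_left)
    qed
    then show ?thesis by blast
  qed
qed

lemma sublinearly_close_imp_asymptotically_close:
  assumes close: "sublinearly_close X Y f g"
  shows "asymptotically_close X Y f g"
proof (cases "mspace X = {}")
  case True
  then show ?thesis
    unfolding asymptotically_close_def
    using Metric_space.mbounded_empty[OF Metric_space_mspace_mdist, of X] by simp
next
  case False
  then obtain x0 where x0: "x0 \<in> mspace X" by blast
  have "((\<lambda>x. mdist Y (f x) (g x) / mdist X x x0) \<longlongrightarrow> 0) (metric_at_infinity X x0)"
  proof (rule tendstoI)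
    fix \<epsilon> :: real assume \<epsilon>: "\<epsilon> > 0"
    then obtain C where C:
      "\<And>x. x \<in> mspace X \<Longrightarrow> mdist Y (f x) (g x) \<le> \<epsilon> / 2 * mdist X x x0 + C"
      using close x0 half_gt_zero[OF \<epsilon>] unfolding sublinearly_close_def by blast
    \<comment> \<open>Beyond \<open>2 * C / \<epsilon>\<close> the constant \<open>C\<close> is
      below half of \<epsilon> times the distance, which uses up the other half of the slope; the
      \<open>+ 1\<close> makes this strict and the bound \<open>1\<close> keeps the denominator
      positive.\<close>
    have "dist (mdist Y (f x) (g x) / mdist X x x0) 0 < \<epsilon>"
      if x: "x \<in> mspace X" "mdist X x x0 \<ge> max 1 (2 * C / \<epsilon> + 1)" for x
    proof -
      have "2 * C / \<epsilon> < mdist X x x0" and pos: "mdist X x x0 > 0"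
        using x(2) by auto
      then have "C < \<epsilon> / 2 * mdist X x x0"
        using \<epsilon> by (simp add: field_simps)
      then have "mdist Y (f x) (g x) < \<epsilon> * mdist X x x0"
        using C[OF x(1)] by simp
      then show ?thesis
        using pos by (simp add: divide_less_eq)
    qed
    then show "\<forall>\<^sub>F x in metric_at_infinity X x0. dist (mdist Y (f x) (g x) / mdist X x x0) 0 < \<epsilon>"
      unfolding eventually_metric_at_infinity by blast
  qed
  then show ?thesis
    unfolding asymptotically_close_def using x0 by blast
qed

section \<open>Sublinear closeness to the identity\<close>

lemma sublinearly_close_refl: "sublinearly_close X X id id"
proof -
  have "mdist X x x \<le> \<epsilon> * mdist X x x0 + 0" if "x \<in> mspace X" "\<epsilon> > 0" for x x0 \<epsilon>
  proof -
    have zero: "mdist X x x = 0"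
      using that by simp
    show ?thesis
      unfolding zero using that by simp
  qed
  then show ?thesis
    unfolding sublinearly_close_def id_apply by blast
qed

text \<open>Used for transitivity on both sides: a trip from \<open>X\<close> to \<open>Y\<close>
  and back is extended by a detour \<open>p\<close> starting and ending in \<open>Y\<close>.\<close>

lemma sublinearly_close_id_compose:
  assumes f: "coarse_Lipschitz_map X Y f" and g: "coarse_Lipschitz_map Y X g"
    and p: "coarse_Lipschitz_map Y Y p"
    and gf: "sublinearly_close X X (g \<circ> f) id" and p_id: "sublinearly_close Y Y p id"
  shows "sublinearly_close X X (g \<circ> p \<circ> f) id"
  unfolding sublinearly_close_def
proof (intro ballI allI impI)
  fix x0 and \<epsilon> :: real assume x0: "x0 \<in> mspace X" and \<epsilon>: "\<epsilon> > 0"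
  obtain L where L: "L > 0" "\<And>x. x \<in> mspace X \<Longrightarrow> f x \<in> mspace Y"
    "\<And>x x'. x \<in> mspace X \<Longrightarrow> x' \<in> mspace X \<Longrightarrow> mdist Y (f x) (f x') \<le> L * mdist X x x' + L"
    using coarse_Lipschitz_mapE[OF f] by blast
  obtain M where M: "M > 0" "\<And>y. y \<in> mspace Y \<Longrightarrow> g y \<in> mspace X"
    "\<And>y y'. y \<in> mspace Y \<Longrightarrow> y' \<in> mspace Y \<Longrightarrow> mdist X (g y) (g y') \<le> M * mdist Y y y' + M"
    using coarse_Lipschitz_mapE[OF g] by blast
  have p_in: "p y \<in> mspace Y" if "y \<in> mspace Y" for y
    using p that unfolding coarse_Lipschitz_map_def by blast
  \<comment> \<open>The error of \<open>p\<close> is stretched by \<open>L\<close> through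
    \<open>f\<close> and by \<open>M\<close> through \<open>g\<close>; this \<delta> turns it into
    slope \<open>\<epsilon> / 2\<close>, leaving the other half for
    \<open>g \<circ> f\<close>.\<close>
  define \<delta> where "\<delta> = \<epsilon> / (2 * M * L)"
  have \<delta>: "\<delta> > 0" and \<delta>_eq: "M * \<delta> * L = \<epsilon> / 2"
    using \<epsilon> L(1) M(1) by (auto simp: \<delta>_def)
  obtain A where A: "\<And>x. x \<in> mspace X \<Longrightarrow> mdist X (g (f x)) x \<le> \<epsilon> / 2 * mdist X x x0 + A"
    using gf x0 half_gt_zero[OF \<epsilon>] unfolding sublinearly_close_def comp_apply id_apply by blast
  \<comment> \<open>The base point in \<open>Y\<close> is \<open>f x0\<close>, so that the coarse
    Lipschitz bound of \<open>f\<close> converts distances to it into distances to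
    \<open>x0\<close>.\<close>
  obtain B where B: "\<And>y. y \<in> mspace Y \<Longrightarrow> mdist Y (p y) y \<le> \<delta> * mdist Y y (f x0) + B"
    using p_id L(2)[OF x0] \<delta> unfolding sublinearly_close_def id_apply by blast
  have "mdist X (g (p (f x))) x \<le> \<epsilon> * mdist X x x0 + (M * (\<delta> * L + B) + M + A)"
    if x: "x \<in> mspace X" for x
  proof -
    have "mdist Y (p (f x)) (f x) \<le> \<delta> * mdist Y (f x) (f x0) + B"
      using B L(2) x by blast
    also have "\<dots> \<le> \<delta> * (L * mdist X x x0 + L) + B"
      using L(3)[OF x x0] \<delta> by simp
    finally have "M * mdist Y (p (f x)) (f x) \<le> M * (\<delta> * (L * mdist X x x0 + L) + B)"
      using M(1) by simp
    also have "\<dots> = (M * \<delta> * L) * mdist X x x0 + M * (\<delta> * L + B)"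
      by (simp add: algebra_simps)
    finally have "M * mdist Y (p (f x)) (f x) \<le> \<epsilon> / 2 * mdist X x x0 + M * (\<delta> * L + B)"
      unfolding \<delta>_eq .
    moreover have "mdist X (g (p (f x))) (g (f x)) \<le> M * mdist Y (p (f x)) (f x) + M"
      using M(3) p_in L(2) x by blast
    moreover have "mdist X (g (p (f x))) x \<le> mdist X (g (p (f x))) (g (f x)) + mdist X (g (f x)) x"
      using M(2) p_in L(2) x by (intro mdist_triangle) auto
    ultimately show ?thesis using A[OF x] by linarith
  qed
  then show "\<exists>C. \<forall>x \<in> mspace X. mdist X ((g \<circ> p \<circ> f) x) (id x) \<le> \<epsilon> * mdist X x x0 + C"
    unfolding comp_apply id_apply by blast
qed

section \<open>The equivalence relation\<close>

lemma asymptotically_close_compose_id_iff: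
  assumes "coarse_Lipschitz_map X Y f" "coarse_Lipschitz_map Y X g"
  shows "asymptotically_close X X (g \<circ> f) id \<longleftrightarrow> sublinearly_close X X (g \<circ> f) id"
  using asymptotically_close_imp_sublinearly_close[OF coarse_Lipschitz_map_compose[OF assms]
      coarse_Lipschitz_map_id]
    sublinearly_close_imp_asymptotically_close[of X X "g \<circ> f" id]
  by (rule iffI)

lemma asymptotically_coarse_Lipschitz_equivalent_iff:
  "asymptotically_coarse_Lipschitz_equivalent X Y \<longleftrightarrow>
     (\<exists>f g. coarse_Lipschitz_map X Y f \<and> coarse_Lipschitz_map Y X g \<and>
        sublinearly_close X X (g \<circ> f) id \<and> sublinearly_close Y Y (f \<circ> g) id)"
  unfolding asymptotically_coarse_Lipschitz_equivalent_def
  by (intro ex_cong1 conj_cong refl asymptotically_close_compose_id_iff)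

lemma asymptotically_coarse_Lipschitz_equivalent_refl:
  "asymptotically_coarse_Lipschitz_equivalent X X"
  unfolding asymptotically_coarse_Lipschitz_equivalent_iff
  by (intro exI[of _ id]) (simp add: coarse_Lipschitz_map_id sublinearly_close_refl)

lemma asymptotically_coarse_Lipschitz_equivalent_sym:
  assumes "asymptotically_coarse_Lipschitz_equivalent X Y"
  shows "asymptotically_coarse_Lipschitz_equivalent Y X"
  using assms unfolding asymptotically_coarse_Lipschitz_equivalent_def by blast

lemma asymptotically_coarse_Lipschitz_equivalent_trans:
  assumes "asymptotically_coarse_Lipschitz_equivalent X Y"
    and "asymptotically_coarse_Lipschitz_equivalent Y Z"
  shows "asymptotically_coarse_Lipschitz_equivalent X Z"
proof -
  obtain f g where fg: "coarse_Lipschitz_map X Y f" "coarse_Lipschitz_map Y X g"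
    "sublinearly_close X X (g \<circ> f) id" "sublinearly_close Y Y (f \<circ> g) id"
    using assms(1) unfolding asymptotically_coarse_Lipschitz_equivalent_iff by blast
  obtain h k where hk: "coarse_Lipschitz_map Y Z h" "coarse_Lipschitz_map Z Y k"
    "sublinearly_close Y Y (k \<circ> h) id" "sublinearly_close Z Z (h \<circ> k) id"
    using assms(2) unfolding asymptotically_coarse_Lipschitz_equivalent_iff by blast
  have "sublinearly_close X X ((g \<circ> k) \<circ> (h \<circ> f)) id"
    using sublinearly_close_id_compose[OF fg(1,2) coarse_Lipschitz_map_compose[OF hk(1,2)] fg(3) hk(3)]
    by (simp add: comp_assoc)
  \<comment> \<open>Seen from \<open>Z\<close>, the outward map is \<open>k\<close>, the return map
    is \<open>h\<close>, and the detour is \<open>f \<circ> g\<close> through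
    \<open>X\<close>.\<close>
  moreover have "sublinearly_close Z Z ((h \<circ> f) \<circ> (g \<circ> k)) id"
    using sublinearly_close_id_compose[OF hk(2,1) coarse_Lipschitz_map_compose[OF fg(2,1)] hk(4) fg(4)]
    by (simp add: comp_assoc)
  ultimately show ?thesis
    unfolding asymptotically_coarse_Lipschitz_equivalent_iff
    using coarse_Lipschitz_map_compose[OF fg(1) hk(1)] coarse_Lipschitz_map_compose[OF hk(2) fg(2)]
    by blast
qed

text \<open>The spaces may have different carrier types, so the three properties are stated
  separately rather than for a relation on a single type.\<close>

theorem proposition2p6:
  shows "(\<forall>X :: 'a metric. asymptotically_coarse_Lipschitz_equivalent X X) \<and>
    (\<forall>(X :: 'a metric) (Y :: 'b metric).
       asymptotically_coarse_Lipschitz_equivalent X Y \<longrightarrow>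
       asymptotically_coarse_Lipschitz_equivalent Y X) \<and>
    (\<forall>(X :: 'a metric) (Y :: 'b metric) (Z :: 'c metric).
       asymptotically_coarse_Lipschitz_equivalent X Y \<longrightarrow>
       asymptotically_coarse_Lipschitz_equivalent Y Z \<longrightarrow>
       asymptotically_coarse_Lipschitz_equivalent X Z)"
  using asymptotically_coarse_Lipschitz_equivalent_refl[where ?'a = 'a]
    asymptotically_coarse_Lipschitz_equivalent_sym[where ?'a = 'a and ?'b = 'b]
    asymptotically_coarse_Lipschitz_equivalent_trans[where ?'a = 'a and ?'b = 'b and ?'c = 'c]
  by (intro conjI allI impI)

end
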